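(* For every positive rational number $r$, the complete tripartite graph $K_{1,3,3}$ is (isomorphic to) a subgraph of $G(\mathbb{Q}^5,\sqrt{r})$.
   Context: For $S \subseteq \mathbb{R}$, a positive integer $n$ and $d>0$, $G(S^n,d)$ denotes the graph with vertex set $S^n$ in which two vertices are adjacent if and only if their Euclidean distance is exactly $d$. Subgraphs need not be induced. *)

theory Defs
  imports "HOL-Analysis.Analysis" "Graph_Theory.Graph_Theory"
begin

text \<open>
  As in \<^theory>\<open>Graph_Theory.Digraph\<close>, an undirected graph is represented by a symmetric
  digraph, an edge between \<open>u\<close> and \<open>v\<close> being the two arcs \<open>(u, v)\<close> and \<open>(v, u)\<close>.
\<close>

text \<open>
  The graph $G(S^n, d)$. The dimension $n$ is the cardinality of the index type \<open>'n\<close>; the metric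
  on \<^typ>\<open>real ^ 'n\<close> is the Euclidean one.
\<close>

definition distance_graph :: "real set \<Rightarrow> real \<Rightarrow> (real ^ 'n) pair_pre_digraph" where
  "distance_graph S d =
    (let V = {x. \<forall>i. x $ i \<in> S}
     in \<lparr> pverts = V, parcs = {(x, y). x \<in> V \<and> y \<in> V \<and> dist x y = d} \<rparr>)"

lemma pair_bidirected_digraph_distance_graph:
  "d > 0 \<Longrightarrow> pair_bidirected_digraph (distance_graph S d)"
  by unfold_locales
    (auto simp: distance_graph_def Let_def dist_commute symmetric_def intro!: symI)

text \<open>
  The complete multipartite graph whose parts have the sizes listed in \<open>ks\<close>;
  \<open>(i, j)\<close> is the \<open>j\<close>-th vertex of the \<open>i\<close>-th part.
\<close>

definition complete_multipartite :: "nat list \<Rightarrow> (nat \<times> nat) pair_pre_digraph" where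
  "complete_multipartite ks =
    (let V = {(i, j). i < length ks \<and> j < ks ! i}
     in \<lparr> pverts = V, parcs = {(u, v). u \<in> V \<and> v \<in> V \<and> fst u \<noteq> fst v} \<rparr>)"

lemma pair_graph_complete_multipartite: "pair_graph (complete_multipartite ks)"
proof -
  let ?V = "{(i, j). i < length ks \<and> j < ks ! i}"
  have "?V = (SIGMA i:{..<length ks}. {..<ks ! i})"
    by auto
  then have fin: "finite ?V"
    by simp
  have "finite {(u, v). u \<in> ?V \<and> v \<in> ?V \<and> fst u \<noteq> fst v}"
    by (rule finite_subset[OF _ finite_cartesian_product[OF fin fin]]) auto
  with fin show ?thesis
    by unfold_locales
      (auto simp: complete_multipartite_def Let_def symmetric_def intro!: symI)
qed

definition isomorphic_to_subgraph :: "('a, 'b) pre_digraph \<Rightarrow> ('c, 'd) pre_digraph \<Rightarrow> bool" where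
  "isomorphic_to_subgraph K G \<longleftrightarrow> (\<exists>H. subgraph H G \<and> digraph_iso K H)"

end

theory Submission
  imports Defs "HOL-Number_Theory.Cong"
begin

text \<open>
  Orthogonal vectors of squared length \<open>q\<close> have distance \<open>\<surd>(2q)\<close>, so with \<open>q = r / 2\<close> it suffices to
  find a vector \<open>v\<^sub>1\<close> and sets \<open>U\<close>, \<open>W\<close> of rational vectors, all of squared length \<open>q\<close>, such that
  \<open>v\<^sub>1\<close>, \<open>U\<close> and \<open>W\<close> are mutually orthogonal.
  Write \<open>q = a\<^sup>2 + b\<^sup>2 + c\<^sup>2 + d\<^sup>2\<close> with rational \<open>a, b, c, d\<close>. Multiplying the quaternion units by
  \<open>a + bi + cj + dk\<close> gives pairwise orthogonal rational vectors \<open>v\<^sub>1, \<dots>, v\<^sub>4\<close> of squared length \<open>q\<close>,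
  and a fifth coordinate supplies a unit vector \<open>v\<^sub>5\<close> orthogonal to them. Reflecting \<open>v\<^sub>2\<close> along
  \<open>v\<^sub>2 + t v\<^sub>3\<close>, and \<open>v\<^sub>4\<close> along \<open>v\<^sub>4 + t v\<^sub>5\<close>, for \<open>t = 0, 1, 2, \<dots>\<close> produces arbitrarily large \<open>U\<close>
  and \<open>W\<close>.

  Over a field no descent is needed for the four-square theorem: sums of four squares are closed
  under division, and every prime \<open>p\<close> satisfies \<open>p k = x\<^sup>2 + y\<^sup>2 + 1\<^sup>2 + 0\<^sup>2\<close> for some \<open>0 < k < p\<close>.
\<close>

section \<open>Sums of four rational squares\<close>

definition sum_of_four_squares :: "'a::comm_semiring_1 \<Rightarrow> bool" where
  "sum_of_four_squares x \<longleftrightarrow> (\<exists>a b c d. x = a\<^sup>2 + b\<^sup>2 + c\<^sup>2 + d\<^sup>2)"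

lemma sum_of_four_squares_0 [simp]: "sum_of_four_squares 0"
  unfolding sum_of_four_squares_def by (intro exI[of _ 0]) simp

lemma sum_of_four_squares_square [simp]: "sum_of_four_squares (x\<^sup>2)"
  unfolding sum_of_four_squares_def by (rule exI[of _ x], (rule exI[of _ 0])+) simp

lemma sum_of_four_squares_mult:
  fixes x y :: "'a::comm_ring_1"
  assumes "sum_of_four_squares x" "sum_of_four_squares y"
  shows "sum_of_four_squares (x * y)"
proof -
  obtain a b c d where x: "x = a\<^sup>2 + b\<^sup>2 + c\<^sup>2 + d\<^sup>2"
    using assms(1) unfolding sum_of_four_squares_def by blast
  obtain e f g h where y: "y = e\<^sup>2 + f\<^sup>2 + g\<^sup>2 + h\<^sup>2"
    using assms(2) unfolding sum_of_four_squares_def by blast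
  have "x * y = (a*e + b*f + c*g + d*h)\<^sup>2 + (a*f - b*e + c*h - d*g)\<^sup>2
      + (a*g - b*h - c*e + d*f)\<^sup>2 + (a*h + b*g - c*f - d*e)\<^sup>2"
    unfolding x y by (simp add: power2_eq_square algebra_simps)
  then show ?thesis
    unfolding sum_of_four_squares_def by blast
qed

lemma sum_of_four_squares_divide:
  fixes x y :: "'a::field"
  assumes "sum_of_four_squares x" "sum_of_four_squares y"
  shows "sum_of_four_squares (x / y)"
proof -
  have "sum_of_four_squares (x * y * (1 / y)\<^sup>2)"
    using assms by (intro sum_of_four_squares_mult) simp_all
  then show ?thesis
    by (cases "y = 0") (simp_all add: power2_eq_square field_simps)
qed

lemma prime_square_cong_imp_eq:
  fixes p x y :: int
  assumes "prime p" "x \<in> {0..p div 2}" "y \<in> {0..p div 2}" "[x\<^sup>2 = y\<^sup>2] (mod p)"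
  shows "x = y"
proof -
  have "p > 1"
    using assms(1) by (rule prime_gt_1_int)
  have "p dvd (x - y) * (x + y)"
    using assms(4) by (simp add: cong_iff_dvd_diff power2_eq_square algebra_simps)
  then consider "p dvd x - y" | "p dvd x + y"
    using assms(1) by (auto simp: prime_dvd_mult_iff)
  then show ?thesis
  proof cases
    case 1
    then have "[x = y] (mod p)"
      by (simp add: cong_iff_dvd_diff)
    moreover have "x < p" "y < p"
      using assms(2,3) \<open>p > 1\<close> by auto
    ultimately show ?thesis
      using assms(2,3) by (intro cong_less_imp_eq_int) auto
  next
    case 2
    then have "x + y \<le> 0 \<or> p \<le> x + y"
      using zdvd_imp_le by force
    then show ?thesis
      using assms(2,3) by auto
  qed
qed

lemma prime_residue_sum_of_two_squares:
  fixes p c :: int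
  assumes "prime p"
  obtains x y where "x \<in> {0..p div 2}" "y \<in> {0..p div 2}" "[x\<^sup>2 + y\<^sup>2 = c] (mod p)"
proof -
  let ?I = "{0..p div 2}"
  let ?A = "(\<lambda>x. x\<^sup>2 mod p) ` ?I" and ?B = "(\<lambda>y. (c - y\<^sup>2) mod p) ` ?I"
  have "p > 1"
    using assms by (rule prime_gt_1_int)
  have "inj_on (\<lambda>x. x\<^sup>2 mod p) ?I"
    by (rule inj_onI, rule prime_square_cong_imp_eq[OF assms]) (simp_all add: cong_def)
  moreover have "inj_on (\<lambda>y. (c - y\<^sup>2) mod p) ?I"
    by (rule inj_onI, rule prime_square_cong_imp_eq[OF assms])
       (simp_all add: cong_iff_dvd_diff mod_eq_dvd_iff dvd_diff_commute)
  ultimately have "card ?A + card ?B = 2 * nat (p div 2 + 1)"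
    by (simp add: card_image)
  moreover have "card (?A \<union> ?B) \<le> card {0..<p}"
    using \<open>p > 1\<close> by (intro card_mono) auto
  ultimately have "?A \<inter> ?B \<noteq> {}"
    using card_Un_disjoint[of ?A ?B] \<open>p > 1\<close> by auto
  then obtain x y where "x \<in> ?I" "y \<in> ?I" "x\<^sup>2 mod p = (c - y\<^sup>2) mod p"
    by blast
  then show thesis
    by (intro that) (simp_all add: cong_iff_dvd_diff mod_eq_dvd_iff algebra_simps)
qed

lemma prime_multiple_two_squares_plus_one:
  fixes p :: int
  assumes "prime p"
  obtains k x y where "0 < k" "k < p" "p * k = x\<^sup>2 + y\<^sup>2 + 1"
proof -
  have "p \<ge> 2"
    using assms by (rule prime_ge_2_int)
  obtain x y where xy: "x \<in> {0..p div 2}" "y \<in> {0..p div 2}" "[x\<^sup>2 + y\<^sup>2 = - 1] (mod p)"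
    using assms by (rule prime_residue_sum_of_two_squares)
  then have "p dvd x\<^sup>2 + y\<^sup>2 + 1"
    by (simp add: cong_iff_dvd_diff)
  then obtain k where k: "p * k = x\<^sup>2 + y\<^sup>2 + 1"
    by (metis dvdE)
  have "(2 * z)\<^sup>2 \<le> p\<^sup>2" if "z \<in> {0..p div 2}" for z
    using that by (intro power_mono) auto
  from this[OF xy(1)] this[OF xy(2)] have "2 * (p * k) \<le> p\<^sup>2 + 2"
    unfolding k by simp
  also have "\<dots> < 2 * (p * p)"
    using mult_mono[OF \<open>p \<ge> 2\<close> \<open>p \<ge> 2\<close>] \<open>p \<ge> 2\<close> by (simp add: power2_eq_square)
  finally have "k < p"
    using \<open>p \<ge> 2\<close> by simp
  have "p * k > 0"
    unfolding k by (simp add: add_nonneg_pos)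
  then have "k > 0"
    using \<open>p \<ge> 2\<close> by (simp add: zero_less_mult_iff)
  then show thesis
    using \<open>k < p\<close> k by (rule that)
qed

lemma sum_of_four_squares_prime:
  fixes p :: nat
  assumes "prime p"
    and smaller: "\<And>k. k < p \<Longrightarrow> sum_of_four_squares (of_nat k :: 'a::field_char_0)"
  shows "sum_of_four_squares (of_nat p :: 'a)"
proof -
  have "prime (int p)"
    using assms(1) by simp
  then obtain k x y where k: "0 < k" "k < int p" "int p * k = x\<^sup>2 + y\<^sup>2 + 1"
    by (rule prime_multiple_two_squares_plus_one)
  have "of_nat p * of_int k = (of_int (int p * k) :: 'a)"
    by simp
  also have "\<dots> = (of_int x)\<^sup>2 + (of_int y)\<^sup>2 + 1\<^sup>2 + 0\<^sup>2"
    unfolding k(3) by simp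
  finally have "sum_of_four_squares (of_nat p * of_int k :: 'a)"
    unfolding sum_of_four_squares_def by blast
  moreover have "sum_of_four_squares (of_int k :: 'a)"
    using smaller[of "nat k"] k by simp
  ultimately have "sum_of_four_squares (of_nat p * of_int k / of_int k :: 'a)"
    by (rule sum_of_four_squares_divide)
  then show ?thesis
    using k(1) by simp
qed

lemma sum_of_four_squares_of_nat: "sum_of_four_squares (of_nat n :: 'a::field_char_0)"
proof (induction n rule: less_induct)
  case (less n)
  consider "n = 0" | "n = 1" | "prime n" | a b where "n = a * b" "a < n" "b < n"
  proof (cases "n \<le> 1")
    case False
    then obtain p m where p: "prime p" "n = p * m"
      using prime_factor_nat[of n] by (auto elim: dvdE)
    then have "p > 1" "m > 0"
      using False prime_gt_1_nat by (auto intro!: gr0I)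
    with p show ?thesis
      using that(3) that(4)[of p m] by (cases "m = 1") auto
  qed (use that in fastforce)
  then show ?case
  proof cases
    case 1
    then show ?thesis
      by simp
  next
    case 2
    then show ?thesis
      using sum_of_four_squares_square[of "1 :: 'a"] by simp
  next
    case 3
    then show ?thesis
      using less.IH by (rule sum_of_four_squares_prime)
  next
    case (4 a b)
    then show ?thesis
      using sum_of_four_squares_mult[OF less.IH less.IH, of a b] by simp
  qed
qed

lemma sum_of_four_squares_rat:
  fixes q :: rat
  assumes "q \<ge> 0"
  shows "sum_of_four_squares q"
proof -
  obtain a b where "q = of_int a / of_int b" "b > 0"
    using quotient_of_div[of q] quotient_of_denom_pos[of q] by (metis surj_pair)
  with assms have "q = of_nat (nat a) / of_nat (nat b)"
    by (simp add: zero_le_divide_iff)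
  then show ?thesis
    by (metis sum_of_four_squares_of_nat sum_of_four_squares_divide)
qed

section \<open>Embedding complete multipartite graphs\<close>

lemma isomorphic_to_subgraph_with_projI:
  assumes "pair_wf_digraph K" "pair_wf_digraph G"
    and "inj_on f (pverts K)" "f ` pverts K \<subseteq> pverts G"
    and arcs: "\<And>u v. (u, v) \<in> parcs K \<Longrightarrow> (f u, f v) \<in> parcs G"
  shows "isomorphic_to_subgraph (with_proj K) (with_proj G)"
proof -
  interpret K: pair_wf_digraph K by fact
  interpret G: pair_wf_digraph G by fact
  let ?f = "\<lparr> iso_verts = f, iso_arcs = map_prod f f, iso_head = snd, iso_tail = fst \<rparr>"
  let ?H = "app_iso ?f (with_proj K)"
  have "inj_on (map_prod f f) (pverts K \<times> pverts K)"
    by (intro map_prod_inj_on assms)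
  then have "inj_on (map_prod f f) (parcs K)"
    by (rule inj_on_subset) (auto dest: K.in_arcsD1 K.in_arcsD2)
  then have iso: "K.digraph_isomorphism ?f"
    unfolding K.digraph_isomorphism_def
    using assms(3) K.wf_digraph_axioms by simp
  then have "wf_digraph ?H"
    by (rule K.wf_digraphI_app_iso)
  then have "subgraph ?H (with_proj G)"
    unfolding subgraph_def compatible_def
    using assms(4) arcs G.wf_digraph_axioms by auto
  with iso show ?thesis
    unfolding isomorphic_to_subgraph_def digraph_iso_def by blast
qed

lemma pair_graph_in_distance_graphI:
  fixes f :: "'a \<Rightarrow> real ^ 'n"
  assumes "pair_graph K" "d > 0" "inj_on f (pverts K)"
    and coord: "\<And>u k. u \<in> pverts K \<Longrightarrow> f u $ k \<in> S"
    and dist: "\<And>u v. (u, v) \<in> parcs K \<Longrightarrow> dist (f u) (f v) = d"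
  shows "isomorphic_to_subgraph (with_proj K)
           (with_proj (distance_graph S d :: (real ^ 'n) pair_pre_digraph))"
proof (rule isomorphic_to_subgraph_with_projI)
  interpret K: pair_graph K by fact
  interpret G: pair_bidirected_digraph "distance_graph S d :: (real ^ 'n) pair_pre_digraph"
    by (rule pair_bidirected_digraph_distance_graph) fact
  show "pair_wf_digraph K" "pair_wf_digraph (distance_graph S d :: (real ^ 'n) pair_pre_digraph)"
    by unfold_locales
  show "inj_on f (pverts K)"
    by fact
  show "f ` pverts K \<subseteq> pverts (distance_graph S d)"
    using coord by (auto simp: distance_graph_def)
  show "(f u, f v) \<in> parcs (distance_graph S d)" if "(u, v) \<in> parcs K" for u v
    using K.in_arcsD1[OF that] K.in_arcsD2[OF that] coord dist[OF that]
    by (simp add: distance_graph_def)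
qed

lemma complete_multipartite_in_distance_graphI:
  fixes Ps :: "(real ^ 'n) set list"
  assumes "d > 0"
    and fin: "\<And>P. P \<in> set Ps \<Longrightarrow> finite P"
    and coord: "\<And>P x k. P \<in> set Ps \<Longrightarrow> x \<in> P \<Longrightarrow> x $ k \<in> S"
    and dist: "sorted_wrt (\<lambda>P Q. \<forall>x\<in>P. \<forall>y\<in>Q. dist x y = d) Ps"
  shows "isomorphic_to_subgraph (with_proj (complete_multipartite (map card Ps)))
           (with_proj (distance_graph S d :: (real ^ 'n) pair_pre_digraph))"
proof -
  let ?K = "complete_multipartite (map card Ps)"
  define f where "f = (\<lambda>(i, j). from_nat_into (Ps ! i) j)"
  have bij: "bij_betw (\<lambda>j. f (i, j)) {..<card (Ps ! i)} (Ps ! i)" if "i < length Ps" for i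
    using bij_betw_from_nat_into_finite[of "Ps ! i"] fin that by (simp add: f_def)
  then have f_in: "f (i, j) \<in> Ps ! i" if "i < length Ps" "j < card (Ps ! i)" for i j
    using that by (blast dest: bij_betwE)
  have dist_f: "dist (f u) (f v) = d" if "(u, v) \<in> parcs ?K" for u v
  proof -
    obtain i j i' j' where "u = (i, j)" "v = (i', j')"
      by fastforce
    with that have "i \<noteq> i'" "f u \<in> Ps ! i" "f v \<in> Ps ! i'" "i < length Ps" "i' < length Ps"
      by (auto simp: complete_multipartite_def intro!: f_in)
    then show ?thesis
      using dist unfolding sorted_wrt_iff_nth_less by (metis dist_commute linorder_neqE_nat)
  qed
  have "inj_on f (pverts ?K)"
  proof (rule inj_onI)
    fix u v
    assume uv: "u \<in> pverts ?K" "v \<in> pverts ?K" and "f u = f v"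
    then have "(u, v) \<notin> parcs ?K"
      using dist_f \<open>d > 0\<close> by fastforce
    with uv obtain i j j' where ij: "u = (i, j)" "v = (i, j')"
        "i < length Ps" "j < card (Ps ! i)" "j' < card (Ps ! i)"
      by (auto simp: complete_multipartite_def)
    then have "j = j'"
      using inj_onD[OF bij_betw_imp_inj_on[OF bij[of i]], of j j'] \<open>f u = f v\<close> by simp
    with ij show "u = v"
      by simp
  qed
  moreover have "f u $ k \<in> S" if u: "u \<in> pverts ?K" for u k
  proof -
    obtain i j where "u = (i, j)" "i < length Ps" "j < card (Ps ! i)"
      using u by (auto simp: complete_multipartite_def)
    then show ?thesis
      using coord[OF nth_mem f_in] by simp
  qed
  ultimately show ?thesis
    using pair_graph_complete_multipartite \<open>d > 0\<close> dist_f
    by (intro pair_graph_in_distance_graphI[where f = f]) simp_all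
qed

lemma dist_orthogonal:
  assumes "orthogonal x y"
  shows "dist x y = sqrt (x \<bullet> x + y \<bullet> y)"
  using assms by (simp add: dist_norm norm_eq_sqrt_inner inner_diff inner_commute orthogonal_def)

lemma complete_multipartite_orthogonal_spheres:
  fixes Ps :: "(real ^ 'n) set list"
  assumes "q > 0"
    and "\<And>P. P \<in> set Ps \<Longrightarrow> finite P"
    and "\<And>P x k. P \<in> set Ps \<Longrightarrow> x \<in> P \<Longrightarrow> x $ k \<in> S"
    and sphere: "\<And>P x. P \<in> set Ps \<Longrightarrow> x \<in> P \<Longrightarrow> x \<bullet> x = q"
    and orth: "sorted_wrt (\<lambda>P Q. \<forall>x\<in>P. \<forall>y\<in>Q. orthogonal x y) Ps"
  shows "isomorphic_to_subgraph (with_proj (complete_multipartite (map card Ps)))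
           (with_proj (distance_graph S (sqrt (2 * q)) :: (real ^ 'n) pair_pre_digraph))"
proof (rule complete_multipartite_in_distance_graphI)
  show "sorted_wrt (\<lambda>P Q. \<forall>x\<in>P. \<forall>y\<in>Q. dist x y = sqrt (2 * q)) Ps"
    using orth by (rule sorted_wrt_mono_rel[rotated]) (auto simp: dist_orthogonal sphere)
qed (use assms in auto)

section \<open>Rational points on orthogonal circles\<close>

definition rational_points :: "(real ^ 'n) set" where
  "rational_points = {x. \<forall>k. x $ k \<in> \<rat>}"

lemma rational_points_add: "x \<in> rational_points \<Longrightarrow> y \<in> rational_points \<Longrightarrow> x + y \<in> rational_points"
  by (simp add: rational_points_def)

lemma rational_points_diff: "x \<in> rational_points \<Longrightarrow> y \<in> rational_points \<Longrightarrow> x - y \<in> rational_points"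
  by (simp add: rational_points_def)

lemma rational_points_scaleR: "c \<in> \<rat> \<Longrightarrow> x \<in> rational_points \<Longrightarrow> c *\<^sub>R x \<in> rational_points"
  by (simp add: rational_points_def)

lemma rational_points_axis: "c \<in> \<rat> \<Longrightarrow> axis k c \<in> rational_points"
  by (simp add: rational_points_def axis_def)

lemma inner_rational_points: "x \<in> rational_points \<Longrightarrow> y \<in> rational_points \<Longrightarrow> x \<bullet> y \<in> \<rat>"
  by (auto simp: rational_points_def inner_vec_def)

definition reflect_along :: "'a::real_inner \<Rightarrow> 'a \<Rightarrow> 'a" where
  "reflect_along u x = x - (2 * (x \<bullet> u) / (u \<bullet> u)) *\<^sub>R u"

lemma inner_reflect_along_self: "reflect_along u x \<bullet> reflect_along u x = x \<bullet> x"
  by (cases "u = 0") (simp_all add: reflect_along_def inner_simps inner_commute field_simps)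

lemma rational_points_reflect_along:
  assumes "u \<in> rational_points" "x \<in> rational_points"
  shows "reflect_along u x \<in> rational_points"
  unfolding reflect_along_def using assms
  by (intro rational_points_diff rational_points_scaleR Rats_divide Rats_mult inner_rational_points)
     simp_all

lemma reflect_along_in_span:
  assumes "u \<in> span A" "x \<in> span A"
  shows "reflect_along u x \<in> span A"
  unfolding reflect_along_def using assms by (intro span_diff span_scale)

lemma inj_on_reflect_along:
  fixes v w :: "'a::real_inner"
  assumes "orthogonal v w" "v \<noteq> 0" "w \<noteq> 0"
  shows "inj_on (\<lambda>t. reflect_along (v + t *\<^sub>R w) v) {0..}"
proof (rule inj_onI)
  fix s t :: real
  assume st: "s \<in> {0..}" "t \<in> {0..}"
    and eq: "reflect_along (v + s *\<^sub>R w) v = reflect_along (v + t *\<^sub>R w) v"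
  have inner_v: "reflect_along (v + a *\<^sub>R w) v \<bullet> v
      = v \<bullet> v - 2 * (v \<bullet> v)\<^sup>2 / (v \<bullet> v + a\<^sup>2 * (w \<bullet> w))" for a
    using assms(1) unfolding reflect_along_def orthogonal_def
    by (simp add: inner_simps inner_commute power2_eq_square mult.assoc)
  have "2 * (v \<bullet> v)\<^sup>2 / (v \<bullet> v + s\<^sup>2 * (w \<bullet> w)) = 2 * (v \<bullet> v)\<^sup>2 / (v \<bullet> v + t\<^sup>2 * (w \<bullet> w))"
    using arg_cong[OF eq, of "\<lambda>x. x \<bullet> v"] unfolding inner_v by simp
  then have "s\<^sup>2 = t\<^sup>2"
    using assms(2,3) by simp
  then show "s = t"
    using st by simp
qed

lemma obtain_rational_circle_points:
  assumes "v \<in> rational_points" "w \<in> rational_points"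
    and "orthogonal v w" "v \<noteq> 0" "w \<noteq> 0"
  obtains P where "finite P" "card P = n" "P \<subseteq> rational_points" "P \<subseteq> span {v, w}"
    "\<And>x. x \<in> P \<Longrightarrow> x \<bullet> x = v \<bullet> v"
proof
  define f where "f k = reflect_along (v + real k *\<^sub>R w) v" for k
  have "inj f"
    using inj_on_reflect_along[OF assms(3-5)] by (fastforce simp: f_def inj_on_def)
  then show "card (f ` {..<n}) = n"
    by (simp add: card_image inj_on_subset)
  show "finite (f ` {..<n})"
    by simp
  show "f ` {..<n} \<subseteq> rational_points"
    unfolding f_def using assms(1,2)
    by (auto intro!: rational_points_reflect_along rational_points_add rational_points_scaleR)
  show "f ` {..<n} \<subseteq> span {v, w}"
    unfolding f_def by (intro image_subsetI reflect_along_in_span span_add span_scale span_base) simp_all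
  show "x \<bullet> x = v \<bullet> v" if "x \<in> f ` {..<n}" for x
    using that by (auto simp: f_def inner_reflect_along_self)
qed

lemma orthogonal_spans:
  assumes "\<And>a b. a \<in> A \<Longrightarrow> b \<in> B \<Longrightarrow> orthogonal a b" "x \<in> span A" "y \<in> span B"
  shows "orthogonal x y"
  using assms by (meson orthogonal_to_span orthogonal_commute)

lemma obtain_distinct_list_of_length:
  assumes "n \<le> card A"
  obtains xs where "set xs \<subseteq> A" "distinct xs" "length xs = n"
proof -
  obtain B where B: "B \<subseteq> A" "finite B" "card B = n"
    using assms by (rule obtain_subset_with_card_n)
  then obtain xs where "set xs = B" "distinct xs"
    using finite_distinct_list by blast
  with B show thesis
    using distinct_card[of xs] by (intro that[of xs]) simp_all
qed

lemma obtain_rational_orthogonal_frame: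
  fixes q :: rat
  assumes "q \<ge> 0" "CARD('n::finite) \<ge> 5"
  obtains v\<^sub>1 v\<^sub>2 v\<^sub>3 v\<^sub>4 v\<^sub>5 :: "real ^ 'n"
  where "{v\<^sub>1, v\<^sub>2, v\<^sub>3, v\<^sub>4, v\<^sub>5} \<subseteq> rational_points" "sorted_wrt orthogonal [v\<^sub>1, v\<^sub>2, v\<^sub>3, v\<^sub>4, v\<^sub>5]"
    "\<And>v. v \<in> {v\<^sub>1, v\<^sub>2, v\<^sub>3, v\<^sub>4} \<Longrightarrow> v \<bullet> v = of_rat q" "v\<^sub>5 \<bullet> v\<^sub>5 = 1"
proof -
  obtain a' b' c' d' where "q = a'\<^sup>2 + b'\<^sup>2 + c'\<^sup>2 + d'\<^sup>2"
    using sum_of_four_squares_rat[OF assms(1)] unfolding sum_of_four_squares_def by blast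
  then have "of_rat q = (of_rat a')\<^sup>2 + (of_rat b')\<^sup>2 + (of_rat c')\<^sup>2 + (of_rat d' :: real)\<^sup>2"
    by (simp add: of_rat_add of_rat_power)
  then obtain a b c d :: real
    where q: "of_rat q = a\<^sup>2 + b\<^sup>2 + c\<^sup>2 + d\<^sup>2" and Rats: "a \<in> \<rat>" "b \<in> \<rat>" "c \<in> \<rat>" "d \<in> \<rat>"
    using Rats_of_rat by blast
  obtain xs :: "'n list" where "distinct xs" "length xs = 5"
    using assms(2) by (rule obtain_distinct_list_of_length)
  then obtain i j k l m :: 'n where distinct: "distinct [i, j, k, l, m]"
    by (auto simp: eval_nat_numeral length_Suc_conv)
  define v\<^sub>1 v\<^sub>2 v\<^sub>3 v\<^sub>4 where
    "v\<^sub>1 = axis i a + axis j b + axis k c + axis l d"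
    "v\<^sub>2 = axis i (- b) + axis j a + axis k (- d) + axis l c"
    "v\<^sub>3 = axis i (- c) + axis j d + axis k a + axis l (- b)"
    "v\<^sub>4 = axis i (- d) + axis j (- c) + axis k b + axis l a"
  note v_defs = this
  show thesis
  proof
    show "{v\<^sub>1, v\<^sub>2, v\<^sub>3, v\<^sub>4, axis m 1} \<subseteq> rational_points"
      using Rats by (simp add: v_defs rational_points_add rational_points_axis)
    show "sorted_wrt orthogonal [v\<^sub>1, v\<^sub>2, v\<^sub>3, v\<^sub>4, axis m 1]"
      using distinct
      by (auto simp: v_defs orthogonal_def inner_simps inner_axis_axis algebra_simps)
    show "v \<bullet> v = of_rat q" if "v \<in> {v\<^sub>1, v\<^sub>2, v\<^sub>3, v\<^sub>4}" for v
      using that distinct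
      by (auto simp: v_defs q inner_simps inner_axis_axis power2_eq_square)
    show "axis m 1 \<bullet> (axis m 1 :: real ^ 'n) = 1"
      by (simp add: inner_axis_axis)
  qed
qed

lemma complete_tripartite_1_m_n_in_rational_distance_graph:
  fixes r :: rat
  assumes "r > 0" "CARD('n::finite) \<ge> 5"
  shows "isomorphic_to_subgraph (with_proj (complete_multipartite [1, m, n]))
           (with_proj (distance_graph \<rat> (sqrt (of_rat r)) :: (real ^ 'n) pair_pre_digraph))"
proof -
  define q where "q = (of_rat (r / 2) :: real)"
  have q: "q > 0" "of_rat r = 2 * q"
    using assms(1) by (simp_all add: q_def of_rat_divide)
  have "r / 2 \<ge> 0"
    using assms(1) by simp
  then obtain v\<^sub>1 v\<^sub>2 v\<^sub>3 v\<^sub>4 v\<^sub>5 :: "real ^ 'n" where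
    rational: "{v\<^sub>1, v\<^sub>2, v\<^sub>3, v\<^sub>4, v\<^sub>5} \<subseteq> rational_points" and
    orth: "sorted_wrt orthogonal [v\<^sub>1, v\<^sub>2, v\<^sub>3, v\<^sub>4, v\<^sub>5]" and
    sphere: "\<And>v. v \<in> {v\<^sub>1, v\<^sub>2, v\<^sub>3, v\<^sub>4} \<Longrightarrow> v \<bullet> v = q" and "v\<^sub>5 \<bullet> v\<^sub>5 = 1"
    using assms(2) unfolding q_def by (rule obtain_rational_orthogonal_frame) blast
  have nonzero: "v\<^sub>2 \<noteq> 0" "v\<^sub>3 \<noteq> 0" "v\<^sub>4 \<noteq> 0" "v\<^sub>5 \<noteq> 0"
    using sphere[of v\<^sub>2] sphere[of v\<^sub>3] sphere[of v\<^sub>4] \<open>q > 0\<close> \<open>v\<^sub>5 \<bullet> v\<^sub>5 = 1\<close> by auto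
  obtain U where U: "finite U" "card U = m" "U \<subseteq> rational_points" "U \<subseteq> span {v\<^sub>2, v\<^sub>3}"
      "\<And>x. x \<in> U \<Longrightarrow> x \<bullet> x = v\<^sub>2 \<bullet> v\<^sub>2"
    by (rule obtain_rational_circle_points[of v\<^sub>2 v\<^sub>3]) (use rational orth nonzero in auto)
  obtain W where W: "finite W" "card W = n" "W \<subseteq> rational_points" "W \<subseteq> span {v\<^sub>4, v\<^sub>5}"
      "\<And>x. x \<in> W \<Longrightarrow> x \<bullet> x = v\<^sub>4 \<bullet> v\<^sub>4"
    by (rule obtain_rational_circle_points[of v\<^sub>4 v\<^sub>5]) (use rational orth nonzero in auto)
  have "isomorphic_to_subgraph (with_proj (complete_multipartite (map card [{v\<^sub>1}, U, W])))
          (with_proj (distance_graph \<rat> (sqrt (2 * q)) :: (real ^ 'n) pair_pre_digraph))"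
  proof (rule complete_multipartite_orthogonal_spheres)
    have "orthogonal v\<^sub>1 x" if "x \<in> U \<union> W" for x
      using that U(4) W(4) orth by (auto intro: orthogonal_to_span)
    moreover have "orthogonal x y" if "x \<in> U" "y \<in> W" for x y
      using that U(4) W(4) orth by (auto intro: orthogonal_spans[of "{v\<^sub>2, v\<^sub>3}" "{v\<^sub>4, v\<^sub>5}"])
    ultimately show "sorted_wrt (\<lambda>P Q. \<forall>x\<in>P. \<forall>y\<in>Q. orthogonal x y) [{v\<^sub>1}, U, W]"
      by simp
  qed (use \<open>q > 0\<close> rational sphere U W in \<open>auto simp: rational_points_def\<close>)
  then show ?thesis
    by (simp add: q(2) U(2) W(2))
qed

theorem theorem3p9:
  fixes r :: rat
  assumes "r > 0"
  shows "isomorphic_to_subgraph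
           (with_proj (complete_multipartite [1, 3, 3]))
           (with_proj (distance_graph \<rat> (sqrt (of_rat r)) :: (real ^ 5) pair_pre_digraph))"
  using assms by (rule complete_tripartite_1_m_n_in_rational_distance_graph) simp

end
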